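(* Let $G$ be a finite group. Then $$\operatorname{gw}(H)\le\operatorname{gw}(G)\quad\text{for any subgroup }H\le G.$$
   Context: For a finite group $G$, the cost of a chain of subgroups $H_0\ge H_1\ge\cdots\ge H_n$ is $\max_{0\le i\le n-1}[H_i:H_{i+1}]$. A chain $G=H_0>H_1>\cdots>H_n=\mathrm{id}$ with strict inclusions is maximal if it cannot be refined to a longer chain by inserting strict subgroups. The Galois width $\operatorname{gw}(G)$ is the minimum cost over all maximal chains of subgroups $G=H_0>\cdots>H_n=\mathrm{id}$. Convention: the maximum over an empty set of indices is $1$ (so the trivial group has Galois width $1$). *)

theory Defs
  imports "HOL-Algebra.Coset" "HOL-Library.Sublist"
begin

text \<open>A chain \<open>H\<^sub>0 \<ge> H\<^sub>1 \<ge> \<dots> \<ge> H\<^sub>n\<close> of subgroups is represented by the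
  nonempty list \<open>[H\<^sub>0, \<dots>, H\<^sub>n]\<close> of their carriers, largest first.\<close>

definition subgroup_chain :: "('a, 'b) monoid_scheme \<Rightarrow> 'a set list \<Rightarrow> bool"
  where "subgroup_chain G Hs \<longleftrightarrow>
    Hs \<noteq> [] \<and> (\<forall>H \<in> set Hs. subgroup H G) \<and> sorted_wrt (\<supseteq>) Hs"

definition subgroup_index :: "('a, 'b) monoid_scheme \<Rightarrow> 'a set \<Rightarrow> 'a set \<Rightarrow> nat"
  where "subgroup_index G H K = card (rcosets\<^bsub>G\<lparr>carrier := H\<rparr>\<^esub> K)"

text \<open>The maximum over an empty set of indices is \<open>1\<close> by convention.\<close>

definition chain_cost :: "('a, 'b) monoid_scheme \<Rightarrow> 'a set list \<Rightarrow> nat"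
  where "chain_cost G Hs =
    (if length Hs \<le> 1 then 1
     else Max ((\<lambda>i. subgroup_index G (Hs ! i) (Hs ! Suc i)) ` {..<length Hs - 1}))"

definition strict_full_chain :: "('a, 'b) monoid_scheme \<Rightarrow> 'a set list \<Rightarrow> bool"
  where "strict_full_chain G Hs \<longleftrightarrow>
    subgroup_chain G Hs \<and> sorted_wrt (\<supset>) Hs \<and> hd Hs = carrier G \<and> last Hs = {\<one>\<^bsub>G\<^esub>}"

definition maximal_chain :: "('a, 'b) monoid_scheme \<Rightarrow> 'a set list \<Rightarrow> bool"
  where "maximal_chain G Hs \<longleftrightarrow>
    strict_full_chain G Hs \<and>
    \<not> (\<exists>Ks. strict_full_chain G Ks \<and> subseq Hs Ks \<and> length Hs < length Ks)"

text \<open>For a finite group a maximal chain exists, so the least element below is attained.\<close>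

definition galois_width :: "('a, 'b) monoid_scheme \<Rightarrow> nat"
  where "galois_width G = (LEAST c. \<exists>Hs. maximal_chain G Hs \<and> c = chain_cost G Hs)"

end

theory Submission
  imports Defs
begin

text \<open>
  Let \<open>G = H\<^sub>0 > \<dots> > H\<^sub>n = 1\<close> be a maximal chain of minimal cost. The groups \<open>H \<inter> H\<^sub>i\<close> form a
  weakly decreasing chain in \<open>H\<close>; after removal of repetitions it refines to a maximal chain
  \<open>K\<^sub>0 > \<dots> > K\<^sub>m\<close> of \<open>H\<close>. Given \<open>j\<close>, let \<open>i\<close> be the last index with \<open>K\<^sub>j \<subseteq> H\<^sub>i\<close>. As
  \<open>H \<inter> H\<^bsub>i+1\<^esub>\<close> is a member of the refined chain that does not contain \<open>K\<^sub>j\<close>, it is contained in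
  \<open>K\<^bsub>j+1\<^esub>\<close>. Hence \<open>K\<^sub>j \<inter> H\<^bsub>i+1\<^esub> \<subseteq> K\<^bsub>j+1\<^esub>\<close>, and \<open>H\<^bsub>i+1\<^esub> a \<mapsto> K\<^bsub>j+1\<^esub> a\<close> (for \<open>a \<in> K\<^sub>j\<close>) is a
  well-defined map from cosets in \<open>H\<^sub>i\<close> onto the cosets of \<open>K\<^bsub>j+1\<^esub>\<close> in \<open>K\<^sub>j\<close>, which gives
  \<open>[K\<^sub>j : K\<^bsub>j+1\<^esub>] \<le> [H\<^sub>i : H\<^bsub>i+1\<^esub>]\<close>. So the new chain costs no more than the old one. This one
  comparison (\<open>subgroup_index_le\<close>) accounts both for the intersection with \<open>H\<close> and for the
  refinement.
\<close>

section \<open>Comparison of indices\<close>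

lemma card_image_le_card_image:
  assumes "finite (f ` A)"
    and "\<And>x y. x \<in> A \<Longrightarrow> y \<in> A \<Longrightarrow> f x = f y \<Longrightarrow> g x = g y"
  shows "card (g ` A) \<le> card (f ` A)"
proof -
  have "g ` A \<subseteq> (\<lambda>y. g (inv_into A f y)) ` f ` A"
  proof
    fix z assume "z \<in> g ` A"
    then obtain x where x: "x \<in> A" "z = g x" by blast
    have "g (inv_into A f (f x)) = g x"
      using x(1) by (intro assms(2)) (auto simp: inv_into_into f_inv_into_f)
    then show "z \<in> (\<lambda>y. g (inv_into A f y)) ` f ` A"
      using x by (metis imageI)
  qed
  then show ?thesis
    using assms(1) surj_card_le by blast
qed

lemma subgroup_index_eq_card_image:
  "subgroup_index G H K = card ((\<lambda>a. K #>\<^bsub>G\<^esub> a) ` H)"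
proof -
  have "rcosets\<^bsub>G\<lparr>carrier := H\<rparr>\<^esub> K = (\<lambda>a. K #>\<^bsub>G\<^esub> a) ` H"
    by (auto simp: RCOSETS_def r_coset_def)
  then show ?thesis
    by (simp add: subgroup_index_def)
qed

text \<open>With \<open>A = H \<inter> C\<close> and \<open>B = H \<inter> D\<close> this bounds the index of an intersection; with
  \<open>D \<subseteq> B \<subseteq> A \<subseteq> C\<close> it bounds a step of a refinement.\<close>

lemma (in group) subgroup_index_le:
  assumes "subgroup A G" "subgroup B G" "subgroup D G"
    and "finite C" "A \<subseteq> C" "A \<inter> D \<subseteq> B"
  shows "subgroup_index G A B \<le> subgroup_index G C D"
proof -
  interpret A: subgroup A G by fact
  interpret B: subgroup B G by fact
  interpret D: subgroup D G by fact
  have "finite A"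
    using assms(4,5) by (rule rev_finite_subset)
  have "card ((\<lambda>a. B #> a) ` A) \<le> card ((\<lambda>a. D #> a) ` A)"
  proof (rule card_image_le_card_image)
    show "finite ((\<lambda>a. D #> a) ` A)"
      using \<open>finite A\<close> by simp
  next
    fix x y assume xy: "x \<in> A" "y \<in> A" "D #> x = D #> y"
    have carr: "x \<in> carrier G" "y \<in> carrier G"
      using xy by auto
    have "x \<in> D #> y"
      using xy(3) rcos_self[OF carr(1) assms(3)] by simp
    then obtain d where d: "d \<in> D" "x = d \<otimes> y"
      by (auto simp: r_coset_def)
    then have "d = x \<otimes> inv y"
      using carr by (simp add: m_assoc)
    then have "d \<in> B"
      using d(1) A.m_closed[OF xy(1) A.m_inv_closed[OF xy(2)]] assms(6) by blast
    then have "x \<in> B #> y"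
      using d by (auto simp: r_coset_def)
    then show "B #> x = B #> y"
      using repr_independence[OF _ carr(2) assms(2)] by simp
  qed
  also have "\<dots> \<le> card ((\<lambda>a. D #> a) ` C)"
    using assms(4,5) by (intro card_mono image_mono) auto
  finally show ?thesis
    by (simp add: subgroup_index_eq_card_image)
qed

lemma subgroup_index_pos:
  assumes "finite H" "H \<noteq> {}"
  shows "1 \<le> subgroup_index G H K"
  using assms by (simp add: subgroup_index_eq_card_image Suc_le_eq card_gt_0_iff)

section \<open>Cost of a chain\<close>

lemma subgroup_index_le_chain_cost:
  assumes "Suc i < length Hs"
  shows "subgroup_index G (Hs ! i) (Hs ! Suc i) \<le> chain_cost G Hs"
  using assms by (auto simp: chain_cost_def intro!: Max_ge)

lemma chain_cost_leI:
  assumes "1 \<le> c"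
    and "\<And>j. Suc j < length Ks \<Longrightarrow> subgroup_index G (Ks ! j) (Ks ! Suc j) \<le> c"
  shows "chain_cost G Ks \<le> c"
proof (cases "length Ks \<le> 1")
  case False
  then have "0 \<in> {..<length Ks - 1}" by simp
  then have "{..<length Ks - 1} \<noteq> {}" by blast
  then show ?thesis
    using assms(2) False by (auto simp: chain_cost_def less_diff_conv)
qed (use assms(1) in \<open>simp add: chain_cost_def\<close>)

lemma chain_cost_pos:
  assumes "group G" "finite (carrier G)" "subgroup_chain G Hs"
  shows "1 \<le> chain_cost G Hs"
proof (cases "length Hs \<le> 1")
  case False
  then have 1: "Suc 0 < length Hs" by simp
  then have "subgroup (Hs ! 0) G"
    using assms(3) by (auto simp: subgroup_chain_def)
  then have "finite (Hs ! 0)" "Hs ! 0 \<noteq> {}"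
    using finite_subset[OF subgroup.subset assms(2)] subgroup.one_closed[of "Hs ! 0" G] by auto
  then have "1 \<le> subgroup_index G (Hs ! 0) (Hs ! Suc 0)"
    by (rule subgroup_index_pos)
  also have "\<dots> \<le> chain_cost G Hs"
    using 1 by (rule subgroup_index_le_chain_cost)
  finally show ?thesis .
qed (simp add: chain_cost_def)

section \<open>Maximal chains through given subgroups\<close>

lemma sorted_wrt_remdups:
  assumes "sorted_wrt P xs"
  shows "sorted_wrt P (remdups xs)"
  using assms by (induction xs) auto

lemma last_remdups:
  "last (remdups xs) = last xs"
  by (induction xs) auto

lemma sorted_wrt_psupset_iff:
  "sorted_wrt (\<supset>) Hs \<longleftrightarrow> sorted_wrt (\<supseteq>) Hs \<and> distinct Hs"
  by (induction Hs) auto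

lemma strict_full_chain_remdups:
  assumes "subgroup_chain G Hs" "hd Hs = carrier G" "last Hs = {\<one>\<^bsub>G\<^esub>}"
  shows "strict_full_chain G (remdups Hs)"
proof -
  have sorted: "sorted_wrt (\<supseteq>) (remdups Hs)"
    using assms(1) by (simp add: subgroup_chain_def sorted_wrt_remdups)
  have ne: "Hs \<noteq> []" "remdups Hs \<noteq> []"
    using assms(1) by (auto simp: subgroup_chain_def)
  have "carrier G \<subseteq> hd (remdups Hs)"
  proof -
    have "carrier G \<in> set (remdups Hs)"
      using assms(2) ne by (metis hd_in_set set_remdups)
    then show ?thesis
      using sorted by (cases "remdups Hs") auto
  qed
  moreover have "hd (remdups Hs) \<subseteq> carrier G"
    using assms(1) ne subgroup.subset hd_in_set[OF ne(2)]
    by (fastforce simp: subgroup_chain_def)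
  ultimately have "hd (remdups Hs) = carrier G" by blast
  then show ?thesis
    using assms sorted ne
    by (auto simp: strict_full_chain_def sorted_wrt_psupset_iff subgroup_chain_def last_remdups)
qed

text \<open>A longest strict chain passing through the given groups is maximal, because a refinement
  still passes through them.\<close>

lemma exists_maximal_chain:
  assumes "finite (carrier G)" "subgroup_chain G Hs" "hd Hs = carrier G" "last Hs = {\<one>\<^bsub>G\<^esub>}"
  obtains Ks where "maximal_chain G Ks" "set Hs \<subseteq> set Ks"
proof -
  let ?P = "\<lambda>Ks. strict_full_chain G Ks \<and> set Hs \<subseteq> set Ks"
  have "?P (remdups Hs)"
    using strict_full_chain_remdups[OF assms(2-4)] by simp
  moreover have "length Ks \<le> card (Pow (carrier G))" if "?P Ks" for Ks
  proof -
    have "distinct Ks" "set Ks \<subseteq> Pow (carrier G)"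
      using that subgroup.subset
      by (fastforce simp: strict_full_chain_def sorted_wrt_psupset_iff subgroup_chain_def)+
    then show ?thesis
      using assms(1) by (metis card_mono distinct_card finite_Pow_iff)
  qed
  ultimately obtain Ks where Ks: "?P Ks" and longest: "\<And>Ls. ?P Ls \<Longrightarrow> length Ls \<le> length Ks"
    using ex_has_greatest_nat[of ?P _ length "Suc (card (Pow (carrier G)))"] by (metis less_Suc_eq_le)
  have "maximal_chain G Ks"
    unfolding maximal_chain_def
  proof (intro conjI notI)
    show "strict_full_chain G Ks"
      using Ks by simp
  next
    assume "\<exists>Ls. strict_full_chain G Ls \<and> subseq Ks Ls \<and> length Ks < length Ls"
    then obtain Ls where Ls: "strict_full_chain G Ls" "subseq Ks Ls" "length Ks < length Ls"
      by blast
    have "set Ks \<subseteq> set Ls"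
      using Ls(2) by (auto simp: subseq_conv_nths dest: in_set_nthsD)
    then show False
      using longest[of Ls] Ls(1,3) Ks by auto
  qed
  then show ?thesis
    using that Ks by blast
qed

lemma galois_width_le:
  assumes "maximal_chain G Hs"
  shows "galois_width G \<le> chain_cost G Hs"
  unfolding galois_width_def by (rule Least_le) (use assms in blast)

lemma galois_width_attained:
  assumes "group G" "finite (carrier G)"
  obtains Hs where "maximal_chain G Hs" "galois_width G = chain_cost G Hs"
proof -
  interpret group G by fact
  have "subgroup_chain G [carrier G, {\<one>\<^bsub>G\<^esub>}]"
    using subgroup_self triv_subgroup by (simp add: subgroup_chain_def)
  then obtain Ks where "maximal_chain G Ks"
    by (rule exists_maximal_chain[OF assms(2)]) auto
  then have "\<exists>c Hs. maximal_chain G Hs \<and> c = chain_cost G Hs"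
    by blast
  then have "\<exists>Hs. maximal_chain G Hs \<and> galois_width G = chain_cost G Hs"
    unfolding galois_width_def by (rule LeastI_ex)
  then show ?thesis
    using that by blast
qed

section \<open>Restriction to a subgroup\<close>

text \<open>The comparison of chains: \<open>Hs\<close> is a full chain of \<open>G\<close>, and \<open>Ks\<close> a strictly decreasing chain
  inside \<open>H\<close> that passes through all the intersections of \<open>H\<close> with the members of \<open>Hs\<close>.\<close>

lemma (in group) chain_cost_le_of_intersections:
  assumes "finite (carrier G)"
    and Hs: "subgroup_chain G Hs" "hd Hs = carrier G" "last Hs = {\<one>}"
    and Ks: "\<And>K. K \<in> set Ks \<Longrightarrow> subgroup K G \<and> K \<subseteq> H" "sorted_wrt (\<supset>) Ks"
    and sub: "(\<lambda>K. H \<inter> K) ` set Hs \<subseteq> set Ks"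
  shows "chain_cost G Ks \<le> chain_cost G Hs"
proof (rule chain_cost_leI)
  show "1 \<le> chain_cost G Hs"
    using group_axioms assms(1) Hs(1) by (rule chain_cost_pos)
next
  fix j assume j: "Suc j < length Ks"
  let ?A = "Ks ! j" and ?B = "Ks ! Suc j"
  have A: "subgroup ?A G" "?A \<subseteq> H" and B: "subgroup ?B G"
    using Ks(1) j by auto
  have "?B \<subset> ?A"
    using sorted_wrt_nth_less[OF Ks(2), of j "Suc j"] j by simp
  have ne: "Hs \<noteq> []"
    using Hs(1) by (simp add: subgroup_chain_def)
  let ?Q = "\<lambda>i. i < length Hs \<and> ?A \<subseteq> Hs ! i"
  have "?Q 0"
    using ne Hs(2) subgroup.subset[OF A(1)] by (simp add: hd_conv_nth)
  moreover have "\<forall>i. ?Q i \<longrightarrow> i \<le> length Hs" by simp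
  ultimately obtain i where i: "?Q i" and last_i: "\<And>k. ?Q k \<Longrightarrow> k \<le> i"
    using Nat.ex_has_greatest_nat[of ?Q 0 "length Hs"] by blast
  have "Suc i \<noteq> length Hs"
  proof
    \<comment> \<open>The last group is trivial, whereas \<open>?A\<close> properly contains a subgroup.\<close>
    assume "Suc i = length Hs"
    then have "?A \<subseteq> {\<one>}"
      using i Hs(3) ne by (metis diff_Suc_1 last_conv_nth)
    then show False
      using \<open>?B \<subset> ?A\<close> subgroup.one_closed[OF B] by blast
  qed
  then have Si: "Suc i < length Hs"
    using i by linarith
  let ?D = "Hs ! Suc i"
  have D: "subgroup ?D G" and C: "subgroup (Hs ! i) G"
    using Hs(1) i Si by (auto simp: subgroup_chain_def)
  have "\<not> ?A \<subseteq> ?D"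
    using last_i[of "Suc i"] Si by auto
  obtain k where k: "k < length Ks" "Ks ! k = H \<inter> ?D"
    using sub Si by (metis image_subset_iff in_set_conv_nth nth_mem)
  \<comment> \<open>The chain \<open>Ks\<close> is decreasing, and its member at \<open>k\<close> does not contain the one at \<open>j\<close>.\<close>
  have "j < k"
  proof (rule ccontr)
    assume "\<not> j < k"
    then have "?A \<subseteq> Ks ! k"
      using sorted_wrt_nth_less[OF Ks(2), of k j] j by (cases "k = j") auto
    then show False
      using k \<open>\<not> ?A \<subseteq> ?D\<close> by auto
  qed
  then have "Ks ! k \<subseteq> ?B"
    using sorted_wrt_nth_less[OF Ks(2), of "Suc j" k] k(1) by (cases "k = Suc j") auto
  then have "?A \<inter> ?D \<subseteq> ?B"
    using k(2) A(2) by auto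
  moreover have "finite (Hs ! i)"
    using assms(1) subgroup.subset[OF C] by (rule rev_finite_subset)
  ultimately have "subgroup_index G ?A ?B \<le> subgroup_index G (Hs ! i) ?D"
    using A(1) B D i by (intro subgroup_index_le) auto
  also have "\<dots> \<le> chain_cost G Hs"
    using Si by (rule subgroup_index_le_chain_cost)
  finally show "subgroup_index G ?A ?B \<le> chain_cost G Hs" .
qed

lemma chain_cost_restrict_carrier:
  "chain_cost (G\<lparr>carrier := H\<rparr>) Ks = chain_cost G Ks"
  by (simp add: chain_cost_def subgroup_index_def)

theorem theorem4:
  fixes G (structure)
  assumes "group G" and "finite (carrier G)" and "subgroup H G"
  shows "galois_width (G\<lparr>carrier := H\<rparr>) \<le> galois_width G"
proof -
  interpret group G by fact
  interpret H: subgroup H G by fact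
  let ?H = "G\<lparr>carrier := H\<rparr>"
  obtain Hs where "maximal_chain G Hs" and gw: "galois_width G = chain_cost G Hs"
    using galois_width_attained assms(1,2) by blast
  then have Hs: "subgroup_chain G Hs" "hd Hs = carrier G" "last Hs = {\<one>}"
    by (auto simp: maximal_chain_def strict_full_chain_def)
  then have ne: "Hs \<noteq> []"
    by (simp add: subgroup_chain_def)
  let ?Ls = "map (\<lambda>K. H \<inter> K) Hs"
  have "subgroup (H \<inter> K) ?H" if "K \<in> set Hs" for K
    using that Hs(1) assms(3)
    by (intro subgroup_incl subgroups_Inter_pair) (auto simp: subgroup_chain_def)
  moreover have "sorted_wrt (\<supseteq>) ?Ls"
    using Hs(1) sorted_wrt_mono_rel[of Hs "(\<supseteq>)" "\<lambda>K L. H \<inter> L \<subseteq> H \<inter> K"]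
    by (auto simp: subgroup_chain_def sorted_wrt_map)
  ultimately have "subgroup_chain ?H ?Ls"
    using ne by (auto simp: subgroup_chain_def)
  moreover have "hd ?Ls = carrier ?H" "last ?Ls = {\<one>\<^bsub>?H\<^esub>}"
    using ne Hs(2,3) H.subset by (auto simp: hd_map last_map)
  moreover have "finite (carrier ?H)"
    using assms(2) H.subset by (auto intro: finite_subset)
  ultimately obtain Ks where Ks: "maximal_chain ?H Ks" "set ?Ls \<subseteq> set Ks"
    using exists_maximal_chain by blast
  then have sgs: "sorted_wrt (\<supset>) Ks" "\<And>K. K \<in> set Ks \<Longrightarrow> subgroup K ?H"
    by (auto simp: maximal_chain_def strict_full_chain_def subgroup_chain_def)
  have "subgroup K G \<and> K \<subseteq> H" if "K \<in> set Ks" for K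
    using incl_subgroup[OF assms(3) sgs(2)[OF that]] subgroup.subset[OF sgs(2)[OF that]] by simp
  then have "chain_cost G Ks \<le> chain_cost G Hs"
    using assms(2) Hs sgs(1) Ks(2) by (intro chain_cost_le_of_intersections) auto
  then show ?thesis
    using galois_width_le[OF Ks(1)] gw by (simp add: chain_cost_restrict_carrier)
qed

end
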